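(* Let $Q$ be a commutative Noetherian monoid. Fix a coprincipal congruence $\sim$ on $Q$ cogenerated by $w$. The soccular closure $\overline\sim$ of $\sim$ relates $a$ and $b$ if and only if $(w:_\sim a)=(w:_\sim b)$.
   Context: Monoids. $Q$ is commutative and Noetherian, written additively. A congruence on $Q$ is an equivalence relation $\sim$ with $a\sim b\Rightarrow a+c\sim b+c$ for all $c\in Q$. An ideal of a monoid is a subset closed under adding arbitrary elements; $\langle q\rangle$ is the ideal generated by $q$. A nil is an absorbing element $\infty$; an element is nilpotent if some positive multiple is nil; $c$ is cancellative if $a+c=b+c\Rightarrow a=b$. A prime $P\subset Q$ is a proper, possibly empty, ideal whose complement is a submonoid. $Q_P$ is the localization of $Q$ along $P$ (inverting $Q\smallsetminus P$); $\bar q$ denotes the image of $q\in Q$ in $\overline Q=Q/{\sim}$ (or in $Q_P/{\sim}$ when so indicated). Green's preorder: $a\le b$ iff $\langle b\rangle\subseteq\langle a\rangle$. Witnesses. For a congruence $\sim$ and a prime $P$: $q\in Q$ is an aide for $w\in Q$ and a generator $p\in P$ if $\bar w\ne\bar q$, $\bar w+\bar p=\bar q+\bar p$, and $\bar q$ is maximal in the set $\{\bar q,\bar w\}$ (under Green's preorder); $q$ is a key aide for $w$ if it is an aide for $w$ for each generator of $P$; $w$ is a key witness for $P$ if it has a key aide. A key witness $w$ is a cogenerator of $\sim$ if $w+p$ is nil modulo $\sim$ for all $p\in P$. Congruences. $\sim$ is $P$-primary if every $p\in P$ is nilpotent in $\overline Q$ and every $f\in Q\smallsetminus P$ is cancellative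 in $\overline Q$. A $P$-primary congruence is mesoprimary if every element $q$ of $\overline Q$ is partly cancellative, i.e. $q+a=q+b\ne\infty\Rightarrow a=b$ for all cancellative $a,b\in\overline Q$. It is coprincipal (or $P$-coprincipal) if it is mesoprimary and every cogenerator for $\sim$ generates the same ideal in $\overline Q$. Soccular collapse and closure. For a $P$-coprincipal congruence $\sim$ with cogenerator $w$, the (first) soccular collapse of $\sim$ is the congruence $\approx$ that sets $a\approx b$ if $a,b\notin\langle w\rangle$ and $a+p\sim b+p$ for all $p\in P$. The $i$-th soccular collapse of $\sim$ is the soccular collapse of the $(i-1)$st soccular collapse of $\sim$. The soccular closure $\overline\sim$ of $\sim$ is the congruence refined by $\sim$ that additionally joins any $a$ and $b$ related under some soccular collapse of $\sim$. Notation: for $P$ the prime for which $\sim$ is $P$-coprincipal, $(w:_\sim q)=\{p\in Q : \bar q+\bar p=\bar w\text{ in }Q_P/{\sim}\}$. *)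

theory Defs
  imports Main
begin

text \<open>
  The monoid \<open>Q\<close> is the type \<open>'a :: comm_monoid_add\<close>. Elements of a quotient \<open>Q/r\<close> are handled
  through representatives in \<open>Q\<close>: a predicate with an argument \<open>r\<close> speaks about the images of
  its arguments in \<open>Q/r\<close>.
\<close>

definition congruence :: "('a::comm_monoid_add \<times> 'a) set \<Rightarrow> bool" where
  "congruence r \<longleftrightarrow> equiv UNIV r \<and> (\<forall>a b c. (a, b) \<in> r \<longrightarrow> (a + c, b + c) \<in> r)"

definition cong_gen :: "('a::comm_monoid_add \<times> 'a) set \<Rightarrow> ('a \<times> 'a) set" where
  "cong_gen S = \<Inter> {r. congruence r \<and> S \<subseteq> r}"

text \<open>Noetherian monoids: the ascending chain condition on congruences.\<close>

definition noetherian_monoid :: "'a::comm_monoid_add itself \<Rightarrow> bool" where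
  "noetherian_monoid _ \<longleftrightarrow>
     (\<forall>C :: nat \<Rightarrow> ('a \<times> 'a) set. (\<forall>i. congruence (C i)) \<and> (\<forall>i. C i \<subseteq> C (Suc i)) \<longrightarrow>
        (\<exists>n. \<forall>m\<ge>n. C m = C n))"

definition monoid_ideal :: "'a::comm_monoid_add set \<Rightarrow> bool" where
  "monoid_ideal I \<longleftrightarrow> (\<forall>q\<in>I. \<forall>c. q + c \<in> I)"

definition prime_ideal :: "'a::comm_monoid_add set \<Rightarrow> bool" where
  "prime_ideal P \<longleftrightarrow> monoid_ideal P \<and> P \<noteq> UNIV \<and>
     0 \<notin> P \<and> (\<forall>a b. a \<notin> P \<longrightarrow> b \<notin> P \<longrightarrow> a + b \<notin> P)"

text \<open>The preimage in \<open>Q\<close> of the ideal of \<open>Q/r\<close> generated by the image of \<open>q\<close>.\<close>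

definition principal :: "('a::comm_monoid_add \<times> 'a) set \<Rightarrow> 'a \<Rightarrow> 'a set" where
  "principal r q = {x. \<exists>c. (x, q + c) \<in> r}"

definition generates :: "'a::comm_monoid_add set \<Rightarrow> 'a set \<Rightarrow> bool" where
  "generates G P \<longleftrightarrow> P = (\<Union>g\<in>G. principal Id g)"

definition green_le :: "('a::comm_monoid_add \<times> 'a) set \<Rightarrow> 'a \<Rightarrow> 'a \<Rightarrow> bool" where
  "green_le r a b \<longleftrightarrow> principal r b \<subseteq> principal r a"

definition nil :: "('a::comm_monoid_add \<times> 'a) set \<Rightarrow> 'a \<Rightarrow> bool" where
  "nil r z \<longleftrightarrow> (\<forall>a. (z + a, z) \<in> r)"

definition nilpotent :: "('a::comm_monoid_add \<times> 'a) set \<Rightarrow> 'a \<Rightarrow> bool" where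
  "nilpotent r q \<longleftrightarrow> (\<exists>n>0. nil r (\<Sum>i<(n::nat). q))"

definition cancellative :: "('a::comm_monoid_add \<times> 'a) set \<Rightarrow> 'a \<Rightarrow> bool" where
  "cancellative r c \<longleftrightarrow> (\<forall>a b. (a + c, b + c) \<in> r \<longrightarrow> (a, b) \<in> r)"

text \<open>
  Green's relation is only a preorder, so "\<open>q\<close> is maximal in \<open>{q, w}\<close>" means that no element of
  \<open>{q, w}\<close> lies strictly above \<open>q\<close>.
\<close>

definition aide :: "('a::comm_monoid_add \<times> 'a) set \<Rightarrow> 'a \<Rightarrow> 'a \<Rightarrow> 'a \<Rightarrow> bool" where
  "aide r q w p \<longleftrightarrow> (w, q) \<notin> r \<and> (w + p, q + p) \<in> r \<and>
     (\<forall>x\<in>{q, w}. green_le r q x \<longrightarrow> green_le r x q)"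

text \<open>
  The choice of the generating set of \<open>P\<close> is immaterial, see \<open>key_aide_iff\<close> below. For
  \<open>P = {}\<close> the condition is vacuous.
\<close>

definition key_aide :: "'a::comm_monoid_add set \<Rightarrow> ('a \<times> 'a) set \<Rightarrow> 'a \<Rightarrow> 'a \<Rightarrow> bool" where
  "key_aide P r q w \<longleftrightarrow> (\<exists>G. generates G P \<and> (\<forall>p\<in>G. aide r q w p))"

definition key_witness :: "'a::comm_monoid_add set \<Rightarrow> ('a \<times> 'a) set \<Rightarrow> 'a \<Rightarrow> bool" where
  "key_witness P r w \<longleftrightarrow> (\<exists>q. key_aide P r q w)"

definition cogenerator :: "'a::comm_monoid_add set \<Rightarrow> ('a \<times> 'a) set \<Rightarrow> 'a \<Rightarrow> bool" where
  "cogenerator P r w \<longleftrightarrow> key_witness P r w \<and> (\<forall>p\<in>P. nil r (w + p))"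

definition primary :: "'a::comm_monoid_add set \<Rightarrow> ('a \<times> 'a) set \<Rightarrow> bool" where
  "primary P r \<longleftrightarrow> (\<forall>p\<in>P. nilpotent r p) \<and> (\<forall>f. f \<notin> P \<longrightarrow> cancellative r f)"

definition partly_cancellative :: "('a::comm_monoid_add \<times> 'a) set \<Rightarrow> 'a \<Rightarrow> bool" where
  "partly_cancellative r q \<longleftrightarrow>
     (\<forall>a b. cancellative r a \<longrightarrow> cancellative r b \<longrightarrow>
        (q + a, q + b) \<in> r \<longrightarrow> \<not> nil r (q + a) \<longrightarrow> (a, b) \<in> r)"

definition mesoprimary :: "'a::comm_monoid_add set \<Rightarrow> ('a \<times> 'a) set \<Rightarrow> bool" where
  "mesoprimary P r \<longleftrightarrow> primary P r \<and> (\<forall>q. partly_cancellative r q)"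

definition coprincipal :: "'a::comm_monoid_add set \<Rightarrow> ('a \<times> 'a) set \<Rightarrow> bool" where
  "coprincipal P r \<longleftrightarrow> mesoprimary P r \<and>
     (\<forall>v w. cogenerator P r v \<longrightarrow> cogenerator P r w \<longrightarrow> principal r v = principal r w)"

text \<open>
  The ideal that is excluded is the one generated by \<open>w\<close> in \<open>Q/r\<close>: with the ideal \<open>w + Q\<close> of
  \<open>Q\<close> the collapse would depend on representatives and could identify \<open>w\<close> with nil. Elements of
  that ideal keep only the relations they already have in \<open>r\<close>.
\<close>

definition soccular_collapse ::
    "'a::comm_monoid_add set \<Rightarrow> 'a \<Rightarrow> ('a \<times> 'a) set \<Rightarrow> ('a \<times> 'a) set" where
  "soccular_collapse P w r = cong_gen (r \<union>
     {(a, b). a \<notin> principal r w \<and> b \<notin> principal r w \<and> (\<forall>p\<in>P. (a + p, b + p) \<in> r)})"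

definition soccular_closure ::
    "'a::comm_monoid_add set \<Rightarrow> 'a \<Rightarrow> ('a \<times> 'a) set \<Rightarrow> ('a \<times> 'a) set" where
  "soccular_closure P w r = (\<Union>i. (soccular_collapse P w ^^ i) r)"

text \<open>
  The congruence on fractions \<open>a - s\<close> (with \<open>s \<notin> P\<close>), written as pairs \<open>(a, s)\<close>, whose quotient is
  \<open>Q\<^sub>P/r\<close>. For \<open>r = Id\<close> its quotient is the localization \<open>Q\<^sub>P\<close>. The image of \<open>q \<in> Q\<close> is the
  class of \<open>(q, 0)\<close>.
\<close>

definition loc_cong ::
    "'a::comm_monoid_add set \<Rightarrow> ('a \<times> 'a) set \<Rightarrow> (('a \<times> 'a) \<times> ('a \<times> 'a)) set" where
  "loc_cong P r = {((a, s), (b, t)). s \<notin> P \<and> t \<notin> P \<and>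
     (\<exists>u. u \<notin> P \<and> (a + t + u, b + s + u) \<in> r)}"

definition colon ::
    "'a::comm_monoid_add set \<Rightarrow> ('a \<times> 'a) set \<Rightarrow> 'a \<Rightarrow> 'a \<Rightarrow> 'a set" where
  "colon P r w q = {p. ((q + p, 0), (w, 0)) \<in> loc_cong P r}"

lemma congruence_iff:
  "congruence r \<longleftrightarrow> (\<forall>a. (a, a) \<in> r) \<and> (\<forall>a b. (a, b) \<in> r \<longrightarrow> (b, a) \<in> r) \<and>
     (\<forall>a b c. (a, b) \<in> r \<longrightarrow> (b, c) \<in> r \<longrightarrow> (a, c) \<in> r) \<and>
     (\<forall>a b c. (a, b) \<in> r \<longrightarrow> (a + c, b + c) \<in> r)"
  by (simp add: congruence_def equiv_def refl_on_def sym_def trans_def)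

lemma congruence_cong_gen: "congruence (cong_gen S)"
proof -
  have mem: "(a, b) \<in> cong_gen S \<longleftrightarrow> (\<forall>r. congruence r \<longrightarrow> S \<subseteq> r \<longrightarrow> (a, b) \<in> r)" for a b
    by (auto simp: cong_gen_def)
  show ?thesis
    unfolding congruence_iff[of "cong_gen S"] mem by (meson congruence_iff)
qed

lemma congruence_soccular_closure:
  assumes "congruence r"
  shows "congruence (soccular_closure P w r)"
proof -
  let ?C = "\<lambda>i. (soccular_collapse P w ^^ i) r"
  have C: "congruence (?C i)" for i
    by (cases i) (simp_all add: assms soccular_collapse_def congruence_cong_gen)
  have "?C i \<subseteq> ?C (Suc i)" for i
    by (auto simp: soccular_collapse_def cong_gen_def)
  then have mono: "i \<le> j \<Longrightarrow> ?C i \<subseteq> ?C j" for i j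
    by (rule lift_Suc_mono_le)
  have trans: "(x, z) \<in> (\<Union>i. ?C i)" if "(x, y) \<in> (\<Union>i. ?C i)" "(y, z) \<in> (\<Union>i. ?C i)" for x y z
  proof -
    from that obtain i j where "(x, y) \<in> ?C i" "(y, z) \<in> ?C j" by blast
    then have "(x, y) \<in> ?C (max i j)" "(y, z) \<in> ?C (max i j)"
      using mono[of i "max i j"] mono[of j "max i j"] by auto
    then have "(x, z) \<in> ?C (max i j)"
      using C[of "max i j"] unfolding congruence_iff by meson
    then show ?thesis by blast
  qed
  have "(x, x) \<in> (\<Union>i. ?C i)" for x
    using C[of 0] unfolding congruence_iff by blast
  moreover have "(y, x) \<in> (\<Union>i. ?C i)" if xy: "(x, y) \<in> (\<Union>i. ?C i)" for x y
  proof -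
    from xy obtain i where "(x, y) \<in> ?C i" by blast
    then have "(y, x) \<in> ?C i" using C[of i] unfolding congruence_iff by meson
    then show ?thesis by blast
  qed
  moreover have "(x + c, y + c) \<in> (\<Union>i. ?C i)" if xy: "(x, y) \<in> (\<Union>i. ?C i)" for x y c
  proof -
    from xy obtain i where "(x, y) \<in> ?C i" by blast
    then have "(x + c, y + c) \<in> ?C i" using C[of i] unfolding congruence_iff by meson
    then show ?thesis by blast
  qed
  ultimately show ?thesis
    unfolding soccular_closure_def congruence_iff using trans by meson
qed

lemma key_aide_iff:
  assumes "congruence r" and "generates G P"
  shows "key_aide P r q w \<longleftrightarrow> (\<forall>p\<in>G. aide r q w p)"
proof
  assume "key_aide P r q w"
  then obtain H where H: "generates H P" and aide: "\<forall>p\<in>H. aide r q w p"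
    by (auto simp: key_aide_def)
  show "\<forall>p\<in>G. aide r q w p"
  proof
    fix p assume "p \<in> G"
    moreover have "p \<in> principal Id p"
      by (auto simp: principal_def intro: exI[of _ 0])
    ultimately have "p \<in> P" using assms(2) by (auto simp: generates_def)
    then obtain h c where h: "h \<in> H" "p = h + c"
      using H by (auto simp: generates_def principal_def)
    then have "aide r q w h" using aide by blast
    moreover from this have "(w + h + c, q + h + c) \<in> r"
      using assms(1) unfolding aide_def congruence_def by meson
    ultimately show "aide r q w p" using h by (simp add: aide_def add.assoc)
  qed
qed (use assms(2) in \<open>auto simp: key_aide_def\<close>)

end

theory Submission
  imports Defs
begin

text \<open>
  Modulo a coprincipal congruence with cogenerator \<open>w\<close>, every element outside \<open>P\<close> is a unit, since
  \<open>w + f\<close> is again a cogenerator for \<open>f \<notin> P\<close>; hence localizing changes nothing and \<open>(w : a)\<close> is just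
  \<open>{p. a + p \<sim> w}\<close>. Adding elements of \<open>P\<close> to a given element reaches nil after finitely many steps,
  and the last element before nil is a cogenerator; hence \<open>(w : a)\<close> is empty only if \<open>a\<close> is nil.
  Equality of \<open>(w : a)\<close> and \<open>(w : b)\<close> is a congruence that survives every collapse, which gives one
  inclusion. The collapses stabilize, and the other inclusion follows by Noetherian induction along
  the addition of elements of \<open>P\<close>.
\<close>

section \<open>Congruences, collapses and a well-founded descent\<close>

lemma congruence_kernel:
  assumes "congruence r"
  shows "congruence {(x, y). (a + x, a + y) \<in> r}"
proof -
  have "(a + (x + c), a + (y + c)) \<in> r" if "(a + x, a + y) \<in> r" for x y c
    using assms that unfolding congruence_iff by (metis add.assoc)
  then show ?thesis
    using assms unfolding congruence_iff mem_Collect_eq case_prod_conv by meson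
qed

lemma cong_gen_least: "congruence s \<Longrightarrow> S \<subseteq> s \<Longrightarrow> cong_gen S \<subseteq> s"
  by (auto simp: cong_gen_def)

lemma cong_gen_upper: "S \<subseteq> cong_gen S"
  by (auto simp: cong_gen_def)

lemma subset_soccular_collapse: "r \<subseteq> soccular_collapse P w r"
  unfolding soccular_collapse_def using cong_gen_upper by blast

lemma soccular_collapseI:
  assumes "a \<notin> principal r w" and "b \<notin> principal r w" and "\<And>p. p \<in> P \<Longrightarrow> (a + p, b + p) \<in> r"
  shows "(a, b) \<in> soccular_collapse P w r"
  unfolding soccular_collapse_def using assms by (intro subsetD[OF cong_gen_upper]) auto

lemma prime_ideal_generates_self: "prime_ideal P \<Longrightarrow> generates P P"
  unfolding generates_def prime_ideal_def monoid_ideal_def principal_def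
  by auto (metis add.right_neutral)

text \<open>Along an infinite chain the kernels of translation by \<open>f i\<close> form an
  ascending chain of congruences, which stabilizes. From then on, adding the next \<open>p\<close>
  loses no information, so nilpotence of \<open>p\<close> pulls nil back to \<open>f n\<close>
  itself.\<close>

lemma wf_add_prime_non_nil:
  fixes r :: "('a::comm_monoid_add \<times> 'a) set"
  assumes noeth: "noetherian_monoid TYPE('a)" and cong: "congruence r"
    and nilp: "\<And>p. p \<in> P \<Longrightarrow> nilpotent r p"
  shows "wf {(a + p, a) | a p. p \<in> P \<and> \<not> nil r a}"
  unfolding wf_iff_no_infinite_down_chain
proof
  assume "\<exists>f. \<forall>i. (f (Suc i), f i) \<in> {(a + p, a) | a p. p \<in> P \<and> \<not> nil r a}"
  then obtain f where f: "\<And>i. (f (Suc i), f i) \<in> {(a + p, a) | a p. p \<in> P \<and> \<not> nil r a}"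
    by blast
  define C where "C i = {(x, y). (f i + x, f i + y) \<in> r}" for i
  have "C i \<subseteq> C (Suc i)" for i
  proof -
    obtain p where "f (Suc i) = f i + p" using f[of i] by blast
    moreover have "(f i + p + x, f i + p + y) \<in> r" if "(f i + x, f i + y) \<in> r" for x y
      using cong that unfolding congruence_iff by (metis add.assoc add.commute)
    ultimately show ?thesis by (auto simp: C_def)
  qed
  moreover have "congruence (C i)" for i
    unfolding C_def by (rule congruence_kernel[OF cong])
  ultimately obtain n where n: "\<And>m. m \<ge> n \<Longrightarrow> C m = C n"
    using noeth unfolding noetherian_monoid_def by meson
  have stable: "C (Suc n) = C n" by (rule n) simp
  obtain p where p: "f (Suc n) = f n + p" "p \<in> P" "\<not> nil r (f n)" using f[of n] by auto
  let ?z = "\<lambda>k. f n + (\<Sum>i<(k::nat). p)"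
  obtain k where "nil r (\<Sum>i<(k::nat). p)" using nilp[OF p(2)] by (auto simp: nilpotent_def)
  then have ex: "nil r (?z k)"
    using cong unfolding nil_def congruence_iff by (metis add.assoc add.commute)
  define l where "l = (LEAST k. nil r (?z k))"
  have l: "nil r (?z l)" unfolding l_def using ex by (rule LeastI)
  with p(3) obtain m where m: "l = Suc m" by (cases l) auto
  \<comment> \<open>Nilness after \<open>Suc m\<close> copies of \<open>p\<close>, read as a
    relation in the kernel of \<open>f n + p\<close>. Since this equals the kernel of
    \<open>f n\<close>, already \<open>m\<close> copies reach nil.\<close>
  have "((\<Sum>i<m. p) + x, \<Sum>i<m. p) \<in> C (Suc n)" for x
    using spec[OF l[unfolded nil_def m], of x] unfolding C_def p(1) by (simp add: ac_simps)
  then have "nil r (?z m)" unfolding stable by (auto simp: nil_def C_def ac_simps)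
  then have "l \<le> m" unfolding l_def by (rule Least_le)
  then show False using m by simp
qed

section \<open>Nil elements, cogenerators and units\<close>

locale coprincipal_congruence =
  fixes P :: "'a::comm_monoid_add set" and r :: "('a \<times> 'a) set" and w :: 'a
  assumes noeth: "noetherian_monoid TYPE('a)" and prime: "prime_ideal P"
    and cong: "congruence r" and coprin: "coprincipal P r" and cogen: "cogenerator P r w"
begin

lemma r_refl: "(a, a) \<in> r"
  and r_sym: "(a, b) \<in> r \<Longrightarrow> (b, a) \<in> r"
  and r_trans [trans]: "(a, b) \<in> r \<Longrightarrow> (b, c) \<in> r \<Longrightarrow> (a, c) \<in> r"
  and r_add: "(a, b) \<in> r \<Longrightarrow> (a + c, b + c) \<in> r"
  using cong unfolding congruence_iff by blast+

lemma nilpotent_prime: "p \<in> P \<Longrightarrow> nilpotent r p"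
  and cancel: "f \<notin> P \<Longrightarrow> (a + f, b + f) \<in> r \<Longrightarrow> (a, b) \<in> r"
  and cancellative_compl: "f \<notin> P \<Longrightarrow> cancellative r f"
  using coprin unfolding coprincipal_def mesoprimary_def primary_def cancellative_def by auto

lemma zero_notin_prime: "0 \<notin> P"
  using prime by (simp add: prime_ideal_def)

lemma nil_unique: "nil r y \<Longrightarrow> nil r z \<Longrightarrow> (y, z) \<in> r"
  unfolding nil_def by (metis add.commute r_sym r_trans)

lemma nil_add: "nil r y \<Longrightarrow> nil r (y + c)"
  unfolding nil_def by (metis add.assoc r_sym r_trans)

lemma nil_cong: "(y, z) \<in> r \<Longrightarrow> nil r y \<Longrightarrow> nil r z"
  unfolding nil_def by (meson r_add r_sym r_trans)

lemma nil_cancel: "f \<notin> P \<Longrightarrow> nil r (y + f) \<Longrightarrow> nil r y"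
  unfolding nil_def by (rule allI, rule cancel[of f]) (simp_all add: ac_simps)

lemma ex_nil: "p \<in> P \<Longrightarrow> \<exists>z. nil r z"
  using nilpotent_prime unfolding nilpotent_def by blast

lemma self_in_principal: "x \<in> principal r x"
  unfolding principal_def mem_Collect_eq by (metis add.right_neutral r_refl)

lemma nil_in_principal: "nil r z \<Longrightarrow> z \<in> principal r y"
  unfolding nil_def principal_def mem_Collect_eq by (metis add.commute r_sym)

lemma principal_nil: "nil r z \<Longrightarrow> x \<in> principal r z \<Longrightarrow> nil r x"
  unfolding principal_def mem_Collect_eq by (meson nil_add nil_cong r_sym)

text \<open>A nil \<open>v\<close> generates the least nonempty ideal, so maximality of its aide
  would make the aide nil too, hence congruent to \<open>v\<close>. The member \<open>p\<close>
  ensures that there is a generator at which to test the aide.\<close>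

lemma cogenerator_not_nil:
  assumes "cogenerator P r v" and "p \<in> P"
  shows "\<not> nil r v"
proof
  assume nil: "nil r v"
  obtain q G where G: "generates G P" and aide: "\<And>g. g \<in> G \<Longrightarrow> aide r q v g"
    using assms(1) unfolding cogenerator_def key_witness_def key_aide_def by blast
  obtain g where "g \<in> G" using G assms(2) by (auto simp: generates_def)
  then have q: "(v, q) \<notin> r" "green_le r q v \<longrightarrow> green_le r v q"
    using aide unfolding aide_def by auto
  have "principal r v \<subseteq> principal r q"
    using principal_nil[OF nil] nil_in_principal by blast
  then have "principal r q \<subseteq> principal r v" using q(2) by (simp add: green_le_def)
  then have "nil r q" using principal_nil[OF nil] self_in_principal by blast
  then show False using nil_unique[OF nil] q(1) by blast
qed

text \<open>Nil serves as a key aide for every such element.\<close>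

lemma cogeneratorI:
  assumes "\<not> nil r v \<or> P = {}" and soc: "\<And>p. p \<in> P \<Longrightarrow> nil r (v + p)"
  shows "cogenerator P r v"
proof -
  obtain z where z: "p \<in> P \<Longrightarrow> nil r z" for p using ex_nil by blast
  have "aide r z v p" if p: "p \<in> P" for p
  proof -
    have "\<not> nil r v" using assms(1) p by blast
    then have "(v, z) \<notin> r" using nil_cong[OF r_sym z[OF p]] by blast
    moreover have "(v + p, z + p) \<in> r"
      by (rule nil_unique[OF soc[OF p] nil_add[OF z[OF p]]])
    moreover have "principal r z \<subseteq> principal r x" for x
      using principal_nil[OF z[OF p]] nil_in_principal by blast
    ultimately show ?thesis by (auto simp: aide_def green_le_def)
  qed
  then show ?thesis
    using soc prime_ideal_generates_self[OF prime]
    unfolding cogenerator_def key_witness_def key_aide_def by blast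
qed

lemma soc: "p \<in> P \<Longrightarrow> nil r (w + p)"
  using cogen by (simp add: cogenerator_def)

lemma principal_cogenerator: "cogenerator P r v \<Longrightarrow> principal r v = principal r w"
  using coprin cogen unfolding coprincipal_def by blast

text \<open>Since \<open>w + f\<close> is again a cogenerator, it generates the same ideal as
  \<open>w\<close>, so some \<open>g\<close> has \<open>w\<close> congruent to
  \<open>w + f + g\<close>. It remains to cancel \<open>w\<close>.\<close>

lemma compl_invertible:
  assumes f: "f \<notin> P"
  obtains g where "(f + g, 0) \<in> r"
proof -
  have "cogenerator P r (w + f)"
  proof (rule cogeneratorI)
    show "\<not> nil r (w + f) \<or> P = {}"
      using nil_cancel[OF f] cogenerator_not_nil[OF cogen] by blast
    show "nil r (w + f + p)" if "p \<in> P" for p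
      using nil_add[OF soc[OF that], of f] by (simp add: ac_simps)
  qed
  then have "w \<in> principal r (w + f)" using principal_cogenerator self_in_principal by blast
  then obtain g where "(w, w + f + g) \<in> r" by (auto simp: principal_def)
  then have g: "(w + 0, w + (f + g)) \<in> r" by (simp add: ac_simps)
  have "(0, f + g) \<in> r"
  \<comment> \<open>For empty \<open>P\<close> the element \<open>w\<close> may be nil, which blocks
    partial cancellativity, but \<open>w\<close> is then itself cancellative.\<close>
  proof (cases "P = {}")
    case True
    show ?thesis by (rule cancel[of w]) (use True g in \<open>simp_all add: ac_simps\<close>)
  next
    case False
    then have not_nil: "\<not> nil r (w + 0)" using cogenerator_not_nil[OF cogen] by auto
    have "g \<notin> P"
    proof
      assume "g \<in> P"
      then have "nil r (w + (f + g))" using nil_add[OF soc[of g], of f] by (simp add: ac_simps)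
      then show False using not_nil nil_cong[OF r_sym[OF g]] by blast
    qed
    then have "f + g \<notin> P" using f prime by (simp add: prime_ideal_def)
    then show ?thesis
      using coprin g not_nil cancellative_compl zero_notin_prime
      unfolding coprincipal_def mesoprimary_def partly_cancellative_def by blast
  qed
  then show ?thesis using r_sym that by blast
qed

section \<open>Colon sets\<close>

lemma mem_colon: "p \<in> colon P r w a \<longleftrightarrow> (a + p, w) \<in> r"
proof
  assume "p \<in> colon P r w a"
  \<comment> \<open>Both denominators are 0, and the remaining \<open>u\<close> outside
    \<open>P\<close> cancels.\<close>
  then show "(a + p, w) \<in> r" by (auto simp: colon_def loc_cong_def intro: cancel)
next
  assume "(a + p, w) \<in> r"
  then show "p \<in> colon P r w a"
    unfolding colon_def loc_cong_def using zero_notin_prime by (auto intro!: exI[of _ 0])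
qed

lemma wf: "wf {(a + p, a) | a p. p \<in> P \<and> \<not> nil r a}"
  by (rule wf_add_prime_non_nil[OF noeth cong]) (rule nilpotent_prime)

text \<open>Descend by adding elements of \<open>P\<close> while the sum stays non-nil. An element
  where this stops is a cogenerator, so \<open>w\<close> lies in its ideal.\<close>

lemma non_nil_colon:
  assumes "\<not> nil r a"
  shows "colon P r w a \<noteq> {}"
  using wf assms
proof (induction a rule: wf_induct_rule)
  case (less a)
  show ?case
  proof (cases "\<forall>p\<in>P. nil r (a + p)")
    case True
    then have "cogenerator P r a" using less.prems by (intro cogeneratorI) auto
    then have "w \<in> principal r a" using principal_cogenerator self_in_principal by blast
    then obtain c where "(w, a + c) \<in> r" by (auto simp: principal_def)
    then have "c \<in> colon P r w a" by (simp add: mem_colon r_sym)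
    then show ?thesis by blast
  next
    case False
    then obtain p where p: "p \<in> P" "\<not> nil r (a + p)" by blast
    then obtain c where "c \<in> colon P r w (a + p)" using less by blast
    then have "p + c \<in> colon P r w a" by (simp add: mem_colon add.assoc)
    then show ?thesis by blast
  qed
qed

text \<open>The member \<open>p\<close> of \<open>P\<close> guarantees that \<open>w\<close> is not
  nil.\<close>

lemma nil_colon:
  assumes "nil r a" and "p \<in> P"
  shows "colon P r w a = {}"
  using nil_cong[OF _ nil_add[OF assms(1)]] cogenerator_not_nil[OF cogen assms(2)] mem_colon
  by blast

section \<open>Equality of colons as a congruence\<close>

definition colon_eq :: "('a \<times> 'a) set" where
  "colon_eq = {(a, b). colon P r w a = colon P r w b}"

lemma colon_eq_iff: "(a, b) \<in> colon_eq \<longleftrightarrow> (\<forall>p. (a + p, w) \<in> r \<longleftrightarrow> (b + p, w) \<in> r)"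
  by (auto simp: colon_eq_def set_eq_iff mem_colon)

lemma congruence_colon_eq: "congruence colon_eq"
  by (auto simp: congruence_iff colon_eq_iff add.assoc)

lemma subset_colon_eq: "r \<subseteq> colon_eq"
  by (rule subrelI, unfold colon_eq_iff) (meson r_add r_sym r_trans)

text \<open>An element \<open>w + c\<close> is nil if \<open>c\<close> is in \<open>P\<close>, which
  an empty colon detects; otherwise it is a unit translate of \<open>w\<close>, and the inverse of
  \<open>c\<close> lies in its colon and pins it down.\<close>

lemma colon_eq_principal:
  assumes "(a, b) \<in> colon_eq" and "a \<in> principal r w"
  shows "(a, b) \<in> r"
proof -
  obtain c where c: "(a, w + c) \<in> r" using assms(2) by (auto simp: principal_def)
  show ?thesis
  proof (cases "c \<in> P")
    case True
    then have a: "nil r a" using nil_cong[OF r_sym[OF c]] soc by blast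
    then have "colon P r w b = {}"
      using nil_colon[OF _ True] assms(1) by (auto simp: colon_eq_def)
    then show ?thesis using non_nil_colon nil_unique[OF a] by blast
  next
    case False
    then obtain d where d: "(c + d, 0) \<in> r" by (rule compl_invertible)
    have unit: "(x + (c + d), x) \<in> r" for x
      using r_add[OF d, of x] by (simp add: add.commute)
    have "(a + d, w) \<in> r"
      using r_trans[OF r_add[OF c, of d]] unit[of w] by (simp add: add.assoc)
    then have "(b + d, w) \<in> r" using assms(1) by (simp add: colon_eq_iff)
    then have "(b + (c + d), w + c) \<in> r" using r_add[of "b + d" w c] by (simp add: ac_simps)
    then show ?thesis using unit[of b] c by (meson r_sym r_trans)
  qed
qed

text \<open>By minimality of the generated congruence only the new pairs matter. Their colons can
  differ neither at \<open>p\<close> in \<open>P\<close>, by assumption on the translates, nor at a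
  unit \<open>p\<close>, which would put \<open>a\<close> into the excluded ideal of
  \<open>w\<close>.\<close>

lemma soccular_collapse_subset_colon_eq:
  assumes "r \<subseteq> s" and "s \<subseteq> colon_eq"
  shows "soccular_collapse P w s \<subseteq> colon_eq"
proof -
  have transfer: "(b + p, w) \<in> r"
    if ab: "a \<notin> principal s w" "\<forall>p\<in>P. (a + p, b + p) \<in> colon_eq" and ap: "(a + p, w) \<in> r" for a b p
  proof (cases "p \<in> P")
    case True
    then have "(a + p, b + p) \<in> colon_eq" using ab(2) by blast
    \<comment> \<open>The colons of \<open>a + p\<close> and \<open>b + p\<close> are compared at
      0.\<close>
    then show ?thesis unfolding colon_eq_iff using ap by (metis add.right_neutral)
  next
    case False
    then obtain d where d: "(p + d, 0) \<in> r" by (rule compl_invertible)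
    have "(a, a + (p + d)) \<in> r"
      using r_sym[OF r_add[OF d, of a]] by (simp add: add.commute)
    also have "(a + (p + d), w + d) \<in> r" using r_add[OF ap, of d] by (simp add: add.assoc)
    finally have "a \<in> principal s w" using assms(1) by (auto simp: principal_def)
    then show ?thesis using ab(1) by contradiction
  qed
  have "(a, b) \<in> colon_eq"
    if "a \<notin> principal s w" "b \<notin> principal s w" "\<forall>p\<in>P. (a + p, b + p) \<in> s" for a b
  proof -
    have ab: "\<forall>p\<in>P. (a + p, b + p) \<in> colon_eq" using that(3) assms(2) by blast
    then have "\<forall>p\<in>P. (b + p, a + p) \<in> colon_eq" by (simp add: colon_eq_iff)
    then show ?thesis
      unfolding colon_eq_iff[of a b] using transfer[OF that(1) ab] transfer[OF that(2)] by blast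
  qed
  then show ?thesis
    unfolding soccular_collapse_def using assms(2)
    by (intro cong_gen_least[OF congruence_colon_eq]) auto
qed

section \<open>Iterated collapses and their stable value\<close>

abbreviation collapse :: "nat \<Rightarrow> ('a \<times> 'a) set" where
  "collapse i \<equiv> (soccular_collapse P w ^^ i) r"

lemma collapse_Suc: "collapse i \<subseteq> collapse (Suc i)"
  using subset_soccular_collapse by simp

lemma subset_collapse: "r \<subseteq> collapse i"
  using lift_Suc_mono_le[of collapse, OF collapse_Suc, of 0 i] by simp

lemma collapse_subset_colon_eq: "collapse i \<subseteq> colon_eq"
  by (induction i)
    (simp_all add: subset_colon_eq subset_collapse soccular_collapse_subset_colon_eq)

lemma collapse_stable: obtains N where "collapse (Suc N) = collapse N"
proof -
  have "congruence (collapse i)" for i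
    by (cases i) (simp_all add: cong soccular_collapse_def congruence_cong_gen)
  then obtain n where "\<And>m. m \<ge> n \<Longrightarrow> collapse m = collapse n"
    using noeth collapse_Suc unfolding noetherian_monoid_def by meson
  then show thesis by (metis that le_SucI order_refl)
qed

text \<open>Every collapse excludes the same ideal: a new member would be
  \<open>colon_eq\<close>-related to some \<open>w + c\<close>, hence already
  \<open>r\<close>-related to it.\<close>

lemma not_in_principal_collapse:
  assumes "a \<notin> principal r w"
  shows "a \<notin> principal (collapse i) w"
proof
  assume "a \<in> principal (collapse i) w"
  then obtain c where "(a, w + c) \<in> colon_eq"
    using collapse_subset_colon_eq by (auto simp: principal_def)
  then have "(w + c, a) \<in> colon_eq" by (simp add: colon_eq_iff)
  moreover have "w + c \<in> principal r w" using r_refl by (auto simp: principal_def)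
  ultimately have "(a, w + c) \<in> r" using colon_eq_principal r_sym by blast
  then show False using assms by (auto simp: principal_def)
qed

text \<open>Outside the ideal of \<open>w\<close>, induction relates all translates of
  \<open>a\<close> and \<open>b\<close> by \<open>P\<close>, so one more collapse joins
  \<open>a\<close> and \<open>b\<close>; stability puts this pair into stage
  \<open>N\<close>.\<close>

lemma colon_eq_subset_stable:
  assumes stable: "collapse (Suc N) = collapse N" and "(a, b) \<in> colon_eq"
  shows "(a, b) \<in> collapse N"
  using wf assms(2)
proof (induction a arbitrary: b rule: wf_induct_rule)
  case (less a)
  have ba: "(b, a) \<in> colon_eq" using less.prems by (simp add: colon_eq_iff)
  show ?case
  proof (cases "a \<in> principal r w \<or> b \<in> principal r w")
    case True
    then have "(a, b) \<in> r"
      using colon_eq_principal[OF less.prems] colon_eq_principal[OF ba] r_sym by blast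
    then show ?thesis using subset_collapse by blast
  next
    case False
    then have not_nil: "\<not> nil r a" using nil_in_principal by blast
    have "(a + p, b + p) \<in> collapse N" if "p \<in> P" for p
    proof (rule less.IH)
      show "(a + p, a) \<in> {(a + p, a) | a p. p \<in> P \<and> \<not> nil r a}" using that not_nil by blast
      show "(a + p, b + p) \<in> colon_eq"
        using less.prems congruence_colon_eq by (simp add: congruence_def)
    qed
    then have "(a, b) \<in> soccular_collapse P w (collapse N)"
      using False not_in_principal_collapse by (intro soccular_collapseI) blast+
    then show ?thesis using stable by simp
  qed
qed

lemma soccular_closure_eq: "soccular_closure P w r = colon_eq"
proof -
  obtain N where "collapse (Suc N) = collapse N" by (rule collapse_stable)
  then have "colon_eq \<subseteq> collapse N" using colon_eq_subset_stable by auto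
  then show ?thesis unfolding soccular_closure_def using collapse_subset_colon_eq by blast
qed

end

theorem corollary3p15:
  fixes P :: "'a::comm_monoid_add set" and r :: "('a \<times> 'a) set" and w a b :: 'a
  assumes "noetherian_monoid TYPE('a)"
    and "prime_ideal P"
    and "congruence r"
    and "coprincipal P r"
    and "cogenerator P r w"
  shows "(a, b) \<in> soccular_closure P w r \<longleftrightarrow> colon P r w a = colon P r w b"
proof -
  interpret coprincipal_congruence P r w
    using assms by unfold_locales
  show ?thesis by (simp add: soccular_closure_eq colon_eq_def)
qed

end
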